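(* Let $n\geqslant 2$ and let $E\subset\mathbb{R}^n$ be an open weakly $1$-semiconvex set whose $1$-nonsemiconvexity-point set $E^{\diamondsuit}$ is non-empty. Then $E^{\diamondsuit}$ is an open subset of $\mathbb{R}^n$.
   Context: $\mathbb{R}^n$ carries the Euclidean norm. A ray is a closed half-line $\{y+t\alpha: t\in[0,+\infty)\}$ with $y\in\mathbb{R}^n$ and $\|\alpha\|=1$; it emanates from $y$. An open set $E\subset\mathbb{R}^n$ is called weakly $1$-semiconvex if for every point $x\in\partial E$ there exists a ray $L$ with $x\in L$ and $L\cap E=\varnothing$ (equivalently, a ray emanating from $x$ with this property). A point $x\in\mathbb{R}^n\setminus E$ is a $1$-nonsemiconvexity point of $E\subset\mathbb{R}^n$ if every ray emanating from $x$ intersects $E$. $E^{\diamondsuit}$ denotes the set of all $1$-nonsemiconvexity points of $E$. *)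

theory Defs
  imports "HOL-Analysis.Analysis"
begin

definition ray_from :: "real ^ 'n \<Rightarrow> real ^ 'n \<Rightarrow> (real ^ 'n) set" where
  "ray_from y \<alpha> = {y + t *\<^sub>R \<alpha> | t. 0 \<le> t}"

definition is_ray_from :: "(real ^ 'n) set \<Rightarrow> real ^ 'n \<Rightarrow> bool" where
  "is_ray_from L y \<longleftrightarrow> (\<exists>\<alpha>. norm \<alpha> = 1 \<and> L = ray_from y \<alpha>)"

definition is_ray :: "(real ^ 'n) set \<Rightarrow> bool" where
  "is_ray L \<longleftrightarrow> (\<exists>y. is_ray_from L y)"

text \<open>The notion is meant for open sets; openness is not part of the predicate. The ray need not
  emanate from \<open>x\<close>, it only has to contain \<open>x\<close>.\<close>

definition weakly_1_semiconvex :: "(real ^ 'n) set \<Rightarrow> bool" where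
  "weakly_1_semiconvex E \<longleftrightarrow> (\<forall>x \<in> frontier E. \<exists>L. is_ray L \<and> x \<in> L \<and> L \<inter> E = {})"

definition nonsemiconvexity_points :: "(real ^ 'n) set \<Rightarrow> (real ^ 'n) set" where
  "nonsemiconvexity_points E = {x. x \<notin> E \<and> (\<forall>L. is_ray_from L x \<longrightarrow> L \<inter> E \<noteq> {})}"

end

theory Submission
  imports Defs
begin

text \<open>By compactness of the unit sphere, the points from which some ray avoids the open set \<open>E\<close>
  form a closed set \<open>C\<close>. Weak semiconvexity puts the frontier of \<open>E\<close> into \<open>C\<close>, so the
  nonsemiconvexity points are the complement of the closed set \<open>C \<union> closure E\<close>.\<close>

text \<open>Take origins converging to \<open>l\<close>, each with a direction whose ray avoids
  \<open>E\<close>. A subsequence of these directions converges on the unit sphere, and its limit is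
  a direction that works for \<open>l\<close>.\<close>

lemma closed_avoiding_ray_origins:
  fixes E :: "'a::euclidean_space set"
  assumes "open E"
  shows "closed {y. \<exists>\<alpha>. norm \<alpha> = 1 \<and> (\<forall>t\<ge>0. y + t *\<^sub>R \<alpha> \<notin> E)}" (is "closed ?C")
  unfolding closed_sequential_limits
proof (intro allI impI, elim conjE)
  fix y l assume y: "\<forall>n. y n \<in> ?C" and lim: "y \<longlonglongrightarrow> l"
  from y obtain \<alpha> where \<alpha>: "\<And>n. \<alpha> n \<in> sphere 0 1"
    and avoid: "\<And>n t. t \<ge> 0 \<Longrightarrow> y n + t *\<^sub>R \<alpha> n \<in> - E"
    by simp metis
  obtain \<beta> r where \<beta>: "\<beta> \<in> sphere 0 1" and r: "strict_mono r" and lim': "(\<alpha> \<circ> r) \<longlonglongrightarrow> \<beta>"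
    using compact_sphere[of "0::'a" 1] \<alpha> unfolding compact_def by blast
  \<comment> \<open>With \<open>t\<close> fixed, the points at parameter \<open>t\<close> on the
    avoiding rays converge within the closed set \<open>- E\<close>; no uniformity in
    \<open>t\<close> is required.\<close>
  have "l + t *\<^sub>R \<beta> \<in> - E" if "t \<ge> 0" for t
  proof (rule closed_sequentially)
    show "closed (- E)" using assms by (simp add: closed_Compl)
    show "(y \<circ> r) n + t *\<^sub>R (\<alpha> \<circ> r) n \<in> - E" for n
      using avoid that by simp
    show "(\<lambda>n. (y \<circ> r) n + t *\<^sub>R (\<alpha> \<circ> r) n) \<longlonglongrightarrow> l + t *\<^sub>R \<beta>"
      by (intro tendsto_intros LIMSEQ_subseq_LIMSEQ lim lim' r)
  qed
  with \<beta> show "l \<in> ?C" by auto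
qed

lemma nonsemiconvexity_points_altdef:
  "nonsemiconvexity_points E =
    - (E \<union> {y. \<exists>\<alpha>. norm \<alpha> = 1 \<and> (\<forall>t\<ge>0. y + t *\<^sub>R \<alpha> \<notin> E)})"
  unfolding nonsemiconvexity_points_def is_ray_from_def ray_from_def by blast

text \<open>Cutting a ray at one of its points leaves a ray with the same direction, so the avoiding
  ray through \<open>x\<close> may be taken to start at \<open>x\<close>.\<close>

lemma weakly_1_semiconvex_frontier:
  assumes "weakly_1_semiconvex E" and "x \<in> frontier E"
  shows "\<exists>\<alpha>. norm \<alpha> = 1 \<and> (\<forall>t\<ge>0. x + t *\<^sub>R \<alpha> \<notin> E)"
proof -
  obtain z \<alpha> where \<alpha>: "norm \<alpha> = 1" and x: "x \<in> ray_from z \<alpha>" and disj: "ray_from z \<alpha> \<inter> E = {}"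
    using assms unfolding weakly_1_semiconvex_def is_ray_def is_ray_from_def by blast
  from x obtain s where s: "s \<ge> 0" "x = z + s *\<^sub>R \<alpha>"
    unfolding ray_from_def by blast
  have "x + t *\<^sub>R \<alpha> \<in> ray_from z \<alpha>" if "t \<ge> 0" for t
    unfolding ray_from_def using s that
    by (auto intro!: exI[of _ "s + t"] simp: algebra_simps)
  with \<alpha> disj show ?thesis by blast
qed

theorem theorem1:
  fixes E :: "(real ^ 'n) set"
  assumes "CARD('n) \<ge> 2"
    and "open E"
    and "weakly_1_semiconvex E"
    and "nonsemiconvexity_points E \<noteq> {}"
  shows "open (nonsemiconvexity_points E)"
proof -
  define C where "C = {y. \<exists>\<alpha>. norm \<alpha> = 1 \<and> (\<forall>t\<ge>0. y + t *\<^sub>R \<alpha> \<notin> E)}"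
  have "frontier E \<subseteq> C"
    using weakly_1_semiconvex_frontier[OF assms(3)] unfolding C_def by blast
  \<comment> \<open>\<open>E\<close> is open, so closedness of the union is not immediate; it holds
    because \<open>C\<close> already contains the frontier points that \<open>E\<close>
    lacks.\<close>
  then have "E \<union> C = closure E \<union> C"
    using closure_Un_frontier[of E] by blast
  moreover have "closed C"
    unfolding C_def by (rule closed_avoiding_ray_origins[OF assms(2)])
  ultimately have "closed (E \<union> C)" by (simp add: closed_Un)
  then show ?thesis
    unfolding nonsemiconvexity_points_altdef C_def[symmetric] by (rule open_Compl)
qed

end
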